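(* Let $X$ be a weighted graph on $n$ vertices, let $M\in\{A(X),L(X),Q(X)\}$, let $U(t)=e^{\mathrm{i}tM}$, let $u$ be a vertex of $X$ and let $\tau>0$. The following are equivalent. (1) Local uniform mixing occurs at $u$ at time $\tau$ (relative to $M$). (2) There exists a vector $\boldsymbol{\mu}\in\mathbb{C}^n$ all of whose entries have modulus $1$ such that $\sqrt{n}\,U(\tau)\mathbf{e}_u=\boldsymbol{\mu}$. (3) There exists a vector $\boldsymbol{\mu}\in\mathbb{C}^n$ all of whose entries have modulus $1$ such that $\sqrt{n}\,e^{\mathrm{i}\tau\lambda}E_\lambda\mathbf{e}_u=E_\lambda\boldsymbol{\mu}$ for all $\lambda\in\Phi_{\mathbf{e}_u}$. Moreover, the condition in (3) is equivalent to: for each eigenpair $(\mathbf{v},\lambda)$ of $M$ with $\lambda\in\Phi_{\mathbf{e}_u}$, $\sqrt{n}\,e^{\mathrm{i}\tau\lambda}(\mathbf{v}^T\mathbf{e}_u)=\mathbf{v}^T\boldsymbol{\mu}$.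
   Context: Graphs are finite, simple, undirected and connected, with positive real edge weights. $A(X)$ is the weighted adjacency matrix, $D(X)$ is the diagonal matrix of vertex degrees (degree = sum of weights of incident edges), $L(X)=D(X)-A(X)$, $Q(X)=D(X)+A(X)$. $\mathbf{e}_u$ is the characteristic vector of $u$. For an eigenvalue $\lambda$ of $M$, $E_\lambda$ is the orthogonal projection onto the $\lambda$-eigenspace of $M$. The eigenvalue support of a vector $\mathbf{x}$ is $\Phi_{\mathbf{x}}=\{\lambda\in\mathrm{spec}(M): E_\lambda\mathbf{x}\neq\mathbf{0}\}$. Local uniform mixing occurs at $u$ at time $\tau>0$ relative to $M$ if every entry of the $u$th column of $U(\tau)$ has modulus $1/\sqrt{n}$. *)

theory Defs
  imports "HOL-Analysis.Analysis"
begin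

text \<open>The vertex set is the finite type \<open>'n\<close>. A weighted graph is given by its set \<open>E\<close> of edges
  (two-element vertex sets) and a weight function \<open>w\<close> that is only relevant on \<open>E\<close>.\<close>

definition connected_weighted_graph :: "'n::finite set set \<Rightarrow> ('n set \<Rightarrow> real) \<Rightarrow> bool" where
  "connected_weighted_graph E w \<longleftrightarrow>
     (\<forall>e\<in>E. card e = 2 \<and> w e > 0) \<and>
     (\<forall>x y. (x, y) \<in> {(a, b). {a, b} \<in> E}\<^sup>*)"

definition adjacency_matrix :: "'n::finite set set \<Rightarrow> ('n set \<Rightarrow> real) \<Rightarrow> real^'n^'n" where
  "adjacency_matrix E w = (\<chi> x y. if {x, y} \<in> E then w {x, y} else 0)"

definition degree_matrix :: "'n::finite set set \<Rightarrow> ('n set \<Rightarrow> real) \<Rightarrow> real^'n^'n" where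
  "degree_matrix E w = (\<chi> x y. if x = y then (\<Sum>e | e \<in> E \<and> x \<in> e. w e) else 0)"

definition laplacian_matrix :: "'n::finite set set \<Rightarrow> ('n set \<Rightarrow> real) \<Rightarrow> real^'n^'n" where
  "laplacian_matrix E w = degree_matrix E w - adjacency_matrix E w"

definition signless_laplacian_matrix :: "'n::finite set set \<Rightarrow> ('n set \<Rightarrow> real) \<Rightarrow> real^'n^'n" where
  "signless_laplacian_matrix E w = degree_matrix E w + adjacency_matrix E w"

definition complex_matrix :: "real^'n^'m \<Rightarrow> complex^'n^'m" where
  "complex_matrix M = (\<chi> i j. complex_of_real (M $ i $ j))"

text \<open>The library's multiplication, and hence \<open>(^)\<close>, on \<open>complex^'n^'n\<close> is entrywise, so powers and
  the exponential with respect to \<open>(**)\<close> are defined here.\<close>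

primrec matrix_power :: "complex^'n^'n \<Rightarrow> nat \<Rightarrow> complex^'n^'n::finite" where
  "matrix_power M 0 = mat 1"
| "matrix_power M (Suc k) = M ** matrix_power M k"

definition matrix_exp :: "complex^'n^'n \<Rightarrow> complex^'n^'n::finite" where
  "matrix_exp M = (\<Sum>k. matrix_power M k /\<^sub>R fact k)"

definition transition_matrix :: "complex^'n^'n \<Rightarrow> real \<Rightarrow> complex^'n^'n::finite" where
  "transition_matrix M t = matrix_exp (\<chi> i j. \<i> * complex_of_real t * M $ i $ j)"

definition local_uniform_mixing :: "complex^'n^'n \<Rightarrow> 'n::finite \<Rightarrow> real \<Rightarrow> bool" where
  "local_uniform_mixing M u \<tau> \<longleftrightarrow>
     (\<forall>x. norm (column u (transition_matrix M \<tau>) $ x) = 1 / sqrt (real CARD('n)))"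

definition eigenspace :: "complex^'n^'n \<Rightarrow> complex \<Rightarrow> (complex^'n::finite) set" where
  "eigenspace M \<theta> = {v. M *v v = \<theta> *s v}"

definition eigenpair :: "complex^'n^'n \<Rightarrow> complex^'n::finite \<Rightarrow> complex \<Rightarrow> bool" where
  "eigenpair M v \<theta> \<longleftrightarrow> v \<noteq> 0 \<and> M *v v = \<theta> *s v"

definition spectrum :: "complex^'n^'n::finite \<Rightarrow> complex set" where
  "spectrum M = {\<theta>. \<exists>v. eigenpair M v \<theta>}"

definition transpose_dot :: "complex^'n \<Rightarrow> complex^'n::finite \<Rightarrow> complex" where
  "transpose_dot v x = (\<Sum>i\<in>UNIV. v $ i * x $ i)"

definition hermitian_inner :: "complex^'n \<Rightarrow> complex^'n::finite \<Rightarrow> complex" where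
  "hermitian_inner x y = (\<Sum>i\<in>UNIV. cnj (x $ i) * y $ i)"

definition orthogonal_projection :: "(complex^'n::finite) set \<Rightarrow> complex^'n \<Rightarrow> complex^'n" where
  "orthogonal_projection S x = (THE y. y \<in> S \<and> (\<forall>z\<in>S. hermitian_inner z (x - y) = 0))"

definition eigenprojection :: "complex^'n^'n \<Rightarrow> complex \<Rightarrow> complex^'n \<Rightarrow> complex^'n::finite" where
  "eigenprojection M \<theta> = orthogonal_projection (eigenspace M \<theta>)"

definition eigenvalue_support :: "complex^'n^'n \<Rightarrow> complex^'n::finite \<Rightarrow> complex set" where
  "eigenvalue_support M x = {\<theta> \<in> spectrum M. eigenprojection M \<theta> x \<noteq> 0}"

definition unimodular :: "complex^'n::finite \<Rightarrow> bool" where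
  "unimodular \<mu> \<longleftrightarrow> (\<forall>i. norm (\<mu> $ i) = 1)"

end

theory Submission
  imports Defs
begin

text \<open>All three matrices are real symmetric, so their eigenvectors span. On an eigenvector for
  \<open>\<theta>\<close> the operator \<open>U(\<tau>)\<close> acts as \<open>exp (\<i> \<tau> \<theta>)\<close>, so (3) says that \<open>\<mu>\<close> and
  \<open>y = \<surd>n U(\<tau>) e\<^sub>u\<close> have the same projections onto the eigenspaces in the support of \<open>e\<^sub>u\<close>. Since
  \<open>y\<close> lies in the sum of these eigenspaces, \<open>y\<close> is orthogonal to \<open>\<mu> - y\<close>; as \<open>U(\<tau>)\<close> is unitary,
  \<open>y\<close> and \<open>\<mu>\<close> both have norm \<open>\<surd>n\<close>, and Pythagoras forces \<open>\<mu> = y\<close>.\<close>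

section \<open>Self-adjoint maps on Euclidean spaces\<close>

text \<open>The linear term dominates near \<open>0\<close>, so a nonzero \<open>b\<close> would
  make the expression negative at some small \<open>t\<close> of sign opposite to
  \<open>b\<close>.\<close>

lemma real_quadratic_nonneg_imp_linear_zero:
  fixes b c :: real
  assumes "\<And>t. 0 \<le> t * b + t\<^sup>2 * c"
  shows "b = 0"
proof (rule ccontr)
  assume b: "b \<noteq> 0"
  \<comment> \<open>At \<open>t = - s * b\<close> the value is
    \<open>s * b\<^sup>2 * (s * c - 1)\<close>, so any positive \<open>s\<close> with
    \<open>s * c < 1\<close> contradicts the assumption; the summand \<open>1\<close> covers
    \<open>c = 0\<close>.\<close>
  define s where "s = 1 / (\<bar>c\<bar> + 1)"
  have s: "s > 0" "s * c < 1"
    unfolding s_def by (auto simp: field_simps)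
  have "0 \<le> (- s * b) * b + (- s * b)\<^sup>2 * c" by (rule assms)
  also have "\<dots> = s * b\<^sup>2 * (s * c - 1)" by (simp add: power2_eq_square algebra_simps)
  also have "\<dots> < 0" using s b by (simp add: mult_pos_neg)
  finally show False by simp
qed

text \<open>A maximiser of the Rayleigh quotient on the unit sphere of \<open>W\<close> is an eigenvector.\<close>

lemma selfadjoint_eigenvector_in_subspace:
  fixes f :: "'a::euclidean_space \<Rightarrow> 'a"
  assumes f: "linear f" and sa: "\<And>x y. inner (f x) y = inner x (f y)"
    and W: "subspace W" and inv: "\<And>x. x \<in> W \<Longrightarrow> f x \<in> W" and w: "w \<in> W" "w \<noteq> 0"
  shows "\<exists>x c. x \<in> W \<and> x \<noteq> 0 \<and> f x = c *\<^sub>R x"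
proof -
  let ?S = "sphere 0 1 \<inter> W"
  have "compact ?S"
    using closed_subspace[OF W] by (simp add: compact_Int_closed)
  moreover have "w /\<^sub>R norm w \<in> ?S"
    using w subspace_scale[OF W] by simp
  moreover have "continuous_on ?S (\<lambda>x. inner x (f x))"
    using f by (intro continuous_intros linear_continuous_on linear_conv_bounded_linear[THEN iffD1])
  ultimately obtain x where x: "x \<in> ?S" and max: "\<And>z. z \<in> ?S \<Longrightarrow> inner z (f z) \<le> inner x (f x)"
    using continuous_attains_sup[of ?S "\<lambda>x. inner x (f x)"] by blast
  define c where "c = inner x (f x)"
  \<comment> \<open>Both sides are homogeneous of degree two, so the bound on the unit sphere
    extends to all of \<open>W\<close> by scaling.\<close>
  have le: "inner z (f z) \<le> c * inner z z" if z: "z \<in> W" for z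
  proof (cases "z = 0")
    case False
    then have "z /\<^sub>R norm z \<in> ?S" using z subspace_scale[OF W] by simp
    from max[OF this] have "inner z (f z) / (norm z)\<^sup>2 \<le> c"
      by (simp add: c_def linear_cmul[OF f] power2_eq_square field_simps)
    then show ?thesis using False
      by (simp add: power2_norm_eq_inner field_simps)
  qed (simp add: linear_0[OF f])
  have xx: "x \<in> W" "inner x x = 1" using x by (auto simp: norm_eq_1)
  \<comment> \<open>The form \<open>c * inner z z - inner z (f z)\<close> is nonnegative on
    \<open>W\<close> and vanishes at \<open>x\<close>, so its first-order term at \<open>x\<close>
    is zero in every direction of \<open>W\<close>. Along the residual \<open>h\<close> that term is
    \<open>2 * inner h h\<close>.\<close>
  define h where "h = c *\<^sub>R x - f x"
  have h: "h \<in> W" unfolding h_def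
    using xx inv subspace_scale[OF W] subspace_diff[OF W] by blast
  have "2 * inner h h = 0"
  proof (rule real_quadratic_nonneg_imp_linear_zero)
    fix t :: real
    have "x + t *\<^sub>R h \<in> W"
      using xx h subspace_scale[OF W] subspace_add[OF W] by blast
    from le[OF this]
    have "0 \<le> c * inner (x + t *\<^sub>R h) (x + t *\<^sub>R h) - inner (x + t *\<^sub>R h) (f (x + t *\<^sub>R h))"
      by simp
    also have "\<dots> = (c * inner x x - inner x (f x)) + t * (2 * (c * inner x h - inner (f x) h))
        + t\<^sup>2 * (c * inner h h - inner h (f h))"
      using sa[of x h]
      by (simp add: linear_add[OF f] linear_cmul[OF f] inner_add_left inner_add_right
          inner_commute power2_eq_square algebra_simps)
    also have "c * inner x x - inner x (f x) = 0" by (simp add: xx c_def)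
    also have "c * inner x h - inner (f x) h = inner h h"
      by (simp add: h_def inner_diff_left)
    finally show "0 \<le> t * (2 * inner h h) + t\<^sup>2 * (c * inner h h - inner h (f h))" by simp
  qed
  then have "f x = c *\<^sub>R x" by (simp add: h_def)
  then show ?thesis using xx by (metis inner_zero_left zero_neq_one)
qed

lemma span_eq_UNIV_if_orthogonal_trivial:
  fixes B :: "'a::euclidean_space set"
  assumes "\<And>x. (\<And>v. v \<in> B \<Longrightarrow> inner v x = 0) \<Longrightarrow> x = 0"
  shows "span B = UNIV"
proof -
  have "x \<in> span B" for x
  proof -
    obtain y z where "y \<in> span B" "\<And>v. v \<in> span B \<Longrightarrow> orthogonal z v" "x = y + z"
      using orthogonal_subspace_decomp_exists[of B x] by metis
    moreover from this have "z = 0"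
      by (intro assms) (simp add: orthogonal_def inner_commute span_base)
    ultimately show ?thesis by simp
  qed
  then show ?thesis by blast
qed

text \<open>In place of an induction on dimension: the orthogonal complement of all eigenvectors is
  invariant by self-adjointness, so if it were nonzero it would contain an eigenvector, which would
  be orthogonal to itself.\<close>

lemma selfadjoint_eigenvectors_span:
  fixes f :: "'a::euclidean_space \<Rightarrow> 'a"
  assumes f: "linear f" and sa: "\<And>x y. inner (f x) y = inner x (f y)"
  shows "span {v. \<exists>c. f v = c *\<^sub>R v} = UNIV"
proof (rule span_eq_UNIV_if_orthogonal_trivial)
  let ?B = "{v. \<exists>c. f v = c *\<^sub>R v}"
  let ?W = "{x. \<forall>v\<in>?B. inner v x = 0}"
  fix w assume "\<And>v. v \<in> ?B \<Longrightarrow> inner v w = 0"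
  then have w: "w \<in> ?W" by blast
  have W: "subspace ?W"
    by (auto simp: subspace_def inner_add_right)
  have inv: "f x \<in> ?W" if "x \<in> ?W" for x
    using that by (auto simp: sa[symmetric])
  show "w = 0"
  proof (rule ccontr)
    assume "w \<noteq> 0"
    then obtain x c where x: "x \<in> ?W" "x \<noteq> 0" "f x = c *\<^sub>R x"
      using selfadjoint_eigenvector_in_subspace[OF f sa W inv w] by blast
    then have "inner x x = 0" by blast
    then show False using x by simp
  qed
qed

section \<open>The Hermitian inner product\<close>

lemma hermitian_inner_add_left: "hermitian_inner (x + y) z = hermitian_inner x z + hermitian_inner y z"
  by (simp add: hermitian_inner_def algebra_simps sum.distrib)

lemma hermitian_inner_add_right: "hermitian_inner z (x + y) = hermitian_inner z x + hermitian_inner z y"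
  by (simp add: hermitian_inner_def algebra_simps sum.distrib)

lemma hermitian_inner_diff_right: "hermitian_inner z (x - y) = hermitian_inner z x - hermitian_inner z y"
  by (simp add: hermitian_inner_def algebra_simps sum_subtractf)

lemma hermitian_inner_scale_left: "hermitian_inner (c *s x) y = cnj c * hermitian_inner x y"
  by (simp add: hermitian_inner_def sum_distrib_left mult_ac)

lemma hermitian_inner_scale_right: "hermitian_inner x (c *s y) = c * hermitian_inner x y"
  by (simp add: hermitian_inner_def sum_distrib_left mult_ac)

lemma hermitian_inner_zero_left [simp]: "hermitian_inner 0 x = 0"
  by (simp add: hermitian_inner_def)

lemma hermitian_inner_zero_right [simp]: "hermitian_inner x 0 = 0"
  by (simp add: hermitian_inner_def)

text \<open>Lets real Euclidean results (spectral theorem, orthogonal decomposition) be applied to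
  complex vectors.\<close>

lemma inner_eq_Re_hermitian_inner: "inner x y = Re (hermitian_inner x y)"
  by (simp add: hermitian_inner_def inner_vec_def inner_complex_def)

lemma hermitian_inner_self: "hermitian_inner x x = complex_of_real ((norm x)\<^sup>2)"
proof -
  have "Im (hermitian_inner x x) = 0"
    by (simp add: hermitian_inner_def mult.commute)
  then show ?thesis
    by (simp add: complex_eq_iff inner_eq_Re_hermitian_inner[symmetric] power2_norm_eq_inner)
qed

lemma hermitian_inner_self_eq_0_iff [simp]: "hermitian_inner x x = 0 \<longleftrightarrow> x = 0"
  by (simp add: hermitian_inner_self)

lemma scaleR_eq_scale_of_real: "r *\<^sub>R (x :: complex^'n::finite) = complex_of_real r *s x"
  by (simp add: vec_eq_iff scaleR_conv_of_real[of r "_ :: complex"])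

text \<open>The real inner product of \<open>z\<close> with \<open>x\<close> gives the real part;
  that of \<open>\<i> *s z\<close>, which also lies in \<open>S\<close>, gives the imaginary
  part.\<close>

lemma hermitian_inner_eq_0_if_inner_eq_0:
  assumes "\<And>z c. z \<in> S \<Longrightarrow> c *s z \<in> S" and "\<And>z. z \<in> S \<Longrightarrow> inner z x = 0" and "z \<in> S"
  shows "hermitian_inner z x = 0"
proof -
  have "inner z x = 0" "inner (\<i> *s z) x = 0" using assms by blast+
  then show ?thesis
    by (simp add: inner_eq_Re_hermitian_inner hermitian_inner_scale_left complex_eq_iff)
qed

text \<open>The description by \<open>THE\<close> is justified here. Existence comes from the real
  orthogonal decomposition, upgraded to Hermitian orthogonality by closure under complex scalars;
  uniqueness holds since the difference of two candidates lies in \<open>S\<close> and is orthogonal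
  to itself.\<close>

lemma orthogonal_projection_props:
  assumes S: "subspace S" and sc: "\<And>z c. z \<in> S \<Longrightarrow> c *s z \<in> S"
  shows orthogonal_projection_in: "orthogonal_projection S x \<in> S"
    and hermitian_inner_orthogonal_projection:
      "z \<in> S \<Longrightarrow> hermitian_inner z (orthogonal_projection S x) = hermitian_inner z x"
proof -
  obtain y r where yr: "y \<in> span S" "\<And>v. v \<in> span S \<Longrightarrow> orthogonal r v" "x = y + r"
    using orthogonal_subspace_decomp_exists[of S x] by metis
  have sp: "span S = S" using S by simp
  have r: "hermitian_inner z r = 0" if "z \<in> S" for z
    by (rule hermitian_inner_eq_0_if_inner_eq_0[OF sc _ that])
      (use yr sp in \<open>auto simp: orthogonal_def inner_commute\<close>)
  let ?P = "\<lambda>y. y \<in> S \<and> (\<forall>z\<in>S. hermitian_inner z (x - y) = 0)"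
  have "?P (THE y. ?P y)"
  proof (rule theI)
    show "?P y" using yr r sp by auto
    fix y' assume y': "?P y'"
    then have m: "y' - y \<in> S" using yr sp subspace_diff[OF S] by simp
    have "hermitian_inner (y' - y) (x - y) - hermitian_inner (y' - y) (x - y') = 0"
      using m \<open>?P y\<close> y' by simp
    then have "hermitian_inner (y' - y) (y' - y) = 0"
      by (simp add: hermitian_inner_diff_right)
    then show "y' = y" by simp
  qed
  then show "orthogonal_projection S x \<in> S"
    and "z \<in> S \<Longrightarrow> hermitian_inner z (orthogonal_projection S x) = hermitian_inner z x"
    by (auto simp: orthogonal_projection_def hermitian_inner_diff_right)
qed

section \<open>Hermitian matrices\<close>

lemma matrix_vector_mult_scaleC: "M *v (c *s x) = c *s (M *v (x :: complex^'n::finite))"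
  by (simp add: vec.scale)

section \<open>Eigenspaces and eigenprojections of an arbitrary complex matrix\<close>

lemma subspace_eigenspace: "subspace (eigenspace M \<theta>)"
  by (auto simp: subspace_def eigenspace_def matrix_vector_right_distrib vector_add_ldistrib
      scaleR_eq_scale_of_real matrix_vector_mult_scaleC vector_smult_assoc mult.commute)

lemma eigenspace_scale: "z \<in> eigenspace M \<theta> \<Longrightarrow> c *s z \<in> eigenspace M \<theta>"
  by (simp add: eigenspace_def matrix_vector_mult_scaleC vector_smult_assoc mult.commute)

lemma eigenprojection_in: "eigenprojection M \<theta> x \<in> eigenspace M \<theta>"
  unfolding eigenprojection_def
  by (rule orthogonal_projection_in[OF subspace_eigenspace eigenspace_scale])

lemma hermitian_inner_eigenprojection:
  "z \<in> eigenspace M \<theta> \<Longrightarrow> hermitian_inner z (eigenprojection M \<theta> x) = hermitian_inner z x"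
  unfolding eigenprojection_def
  by (rule hermitian_inner_orthogonal_projection[OF subspace_eigenspace eigenspace_scale])

lemma scaled_eigenprojection_eq_iff:
  "c *s eigenprojection M \<theta> x = eigenprojection M \<theta> y \<longleftrightarrow>
     (\<forall>z\<in>eigenspace M \<theta>. c * hermitian_inner z x = hermitian_inner z y)"
proof
  assume *: "c *s eigenprojection M \<theta> x = eigenprojection M \<theta> y"
  show "\<forall>z\<in>eigenspace M \<theta>. c * hermitian_inner z x = hermitian_inner z y"
  proof
    fix z assume "z \<in> eigenspace M \<theta>"
    then show "c * hermitian_inner z x = hermitian_inner z y"
      using arg_cong[OF *, of "hermitian_inner z"]
      by (simp add: hermitian_inner_scale_right hermitian_inner_eigenprojection)
  qed
next
  assume *: "\<forall>z\<in>eigenspace M \<theta>. c * hermitian_inner z x = hermitian_inner z y"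
  let ?d = "c *s eigenprojection M \<theta> x - eigenprojection M \<theta> y"
  have "?d \<in> eigenspace M \<theta>"
    by (intro subspace_diff[OF subspace_eigenspace] eigenspace_scale eigenprojection_in)
  with * have "hermitian_inner ?d (c *s eigenprojection M \<theta> x) - hermitian_inner ?d (eigenprojection M \<theta> y) = 0"
    by (simp only: hermitian_inner_scale_right hermitian_inner_eigenprojection) simp
  then have "hermitian_inner ?d ?d = 0"
    by (simp only: hermitian_inner_diff_right)
  then show "c *s eigenprojection M \<theta> x = eigenprojection M \<theta> y" by simp
qed

text \<open>A nonzero projection is itself an eigenvector, so membership in the spectrum comes for
  free.\<close>

lemma eigenvalue_support_alt:
  "\<theta> \<in> eigenvalue_support M x \<longleftrightarrow> (\<exists>z\<in>eigenspace M \<theta>. hermitian_inner z x \<noteq> 0)"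
proof -
  have "eigenprojection M \<theta> x \<noteq> 0 \<Longrightarrow> \<theta> \<in> spectrum M"
    using eigenprojection_in[of M \<theta> x] by (auto simp: spectrum_def eigenpair_def eigenspace_def)
  moreover have "eigenprojection M \<theta> x = 0 \<longleftrightarrow> (\<forall>z\<in>eigenspace M \<theta>. hermitian_inner z x = 0)"
  proof
    assume "eigenprojection M \<theta> x = 0"
    then show "\<forall>z\<in>eigenspace M \<theta>. hermitian_inner z x = 0"
      by (metis hermitian_inner_eigenprojection hermitian_inner_zero_right)
  next
    assume "\<forall>z\<in>eigenspace M \<theta>. hermitian_inner z x = 0"
    then show "eigenprojection M \<theta> x = 0"
      by (metis eigenprojection_in hermitian_inner_eigenprojection hermitian_inner_self_eq_0_iff)
  qed
  ultimately show ?thesis by (auto simp: eigenvalue_support_def)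
qed

section \<open>Hermitian matrices and their eigenvectors\<close>

definition hermitian_matrix :: "complex^'n^'n::finite \<Rightarrow> bool" where
  "hermitian_matrix M \<longleftrightarrow> (\<forall>i j. M $ j $ i = cnj (M $ i $ j))"

lemma hermitian_matrix_selfadjoint:
  assumes "hermitian_matrix M"
  shows "hermitian_inner (M *v x) y = hermitian_inner x (M *v y)"
proof -
  have "hermitian_inner (M *v x) y = (\<Sum>i\<in>UNIV. \<Sum>j\<in>UNIV. cnj (M $ i $ j) * cnj (x $ j) * y $ i)"
    by (simp add: hermitian_inner_def matrix_vector_mult_def sum_distrib_right)
  also have "\<dots> = (\<Sum>j\<in>UNIV. \<Sum>i\<in>UNIV. cnj (M $ i $ j) * cnj (x $ j) * y $ i)"
    by (rule sum.swap)
  also have "\<dots> = hermitian_inner x (M *v y)"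
  proof -
    have "cnj (M $ i $ j) = M $ j $ i" for i j
      using assms by (metis hermitian_matrix_def)
    then show ?thesis
      by (simp add: hermitian_inner_def matrix_vector_mult_def sum_distrib_left mult_ac)
  qed
  finally show ?thesis .
qed

lemma hermitian_matrix_eigenvectors_span:
  assumes "hermitian_matrix M"
  shows "span {v. \<exists>c. v \<in> eigenspace M (complex_of_real c)} = UNIV"
proof -
  have "linear ((*v) M)"
    by (rule linearI) (simp_all add: matrix_vector_right_distrib scaleR_eq_scale_of_real
        matrix_vector_mult_scaleC)
  from selfadjoint_eigenvectors_span[OF this] show ?thesis
    using hermitian_matrix_selfadjoint[OF assms]
    by (simp add: inner_eq_Re_hermitian_inner eigenspace_def scaleR_eq_scale_of_real)
qed

text \<open>Stands in for expansion in an eigenbasis: a property preserved by real linear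
  combinations need only be checked on eigenvectors with real eigenvalue.\<close>

lemma hermitian_matrix_induct [consumes 1, case_names zero add scaleR eigenvector]:
  assumes "hermitian_matrix M" and zero: "P 0" and add: "\<And>x y. P x \<Longrightarrow> P y \<Longrightarrow> P (x + y)"
    and scaleR: "\<And>c x. P x \<Longrightarrow> P (c *\<^sub>R x)"
    and eig: "\<And>v c. v \<in> eigenspace M (complex_of_real c) \<Longrightarrow> P v"
  shows "P x"
proof -
  have "x \<in> span {v. \<exists>c. v \<in> eigenspace M (complex_of_real c)}"
    using hermitian_matrix_eigenvectors_span[OF assms(1)] by simp
  then show ?thesis
  proof (induction rule: span_induct)
    show "subspace {x. P x}" using zero add scaleR by (auto simp: subspace_def)
  qed (use eig in blast)
qed

lemma hermitian_matrix_eigenvalue_real: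
  assumes "hermitian_matrix M" "v \<in> eigenspace M \<theta>" "v \<noteq> 0"
  shows "cnj \<theta> = \<theta>"
  using hermitian_matrix_selfadjoint[OF assms(1), of v v] assms(2,3)
  by (simp add: eigenspace_def hermitian_inner_scale_left hermitian_inner_scale_right)

lemma hermitian_matrix_eigenspaces_orthogonal:
  assumes M: "hermitian_matrix M" and v: "v \<in> eigenspace M \<theta>" and x: "x \<in> eigenspace M \<eta>" and ne: "\<theta> \<noteq> \<eta>"
  shows "hermitian_inner v x = 0"
proof (cases "v = 0")
  case False
  have "cnj \<theta> * hermitian_inner v x = \<eta> * hermitian_inner v x"
    using hermitian_matrix_selfadjoint[OF M, of v x] v x
    by (simp add: eigenspace_def hermitian_inner_scale_left hermitian_inner_scale_right)
  then show ?thesis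
    using hermitian_matrix_eigenvalue_real[OF M v False] ne by simp
qed simp

section \<open>The transition matrix\<close>

lemma matrix_power_eigenvector:
  assumes "N *v v = a *s v"
  shows "matrix_power N k *v v = a ^ k *s v"
proof (induction k)
  case (Suc k)
  then show ?case
    using assms by (simp add: matrix_vector_mul_assoc[symmetric] matrix_vector_mult_scaleC
        vector_smult_assoc mult.commute)
qed simp

lemma matrix_vector_mult_axis: "A *v axis j 1 = column j (A :: 'a::semiring_1^'n^'m::finite)"
  by (simp add: vec_eq_iff matrix_vector_mult_def column_def axis_def if_distrib cong: if_cong)

lemma scaleR_matrix_vector_mult: "(c *\<^sub>R A) *v x = c *\<^sub>R (A *v (x :: complex^'n::finite))"
  by (simp add: vec_eq_iff matrix_vector_mult_def scaleR_sum_right)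

text \<open>Applying the series to unit vectors gives its columns, so pointwise convergence yields
  entrywise convergence and no norm estimate for matrix powers is required.\<close>

lemma matrix_vector_mult_sums:
  fixes A :: "nat \<Rightarrow> complex^'n^'m::finite"
  assumes "\<And>x. summable (\<lambda>k. A k *v x)"
  shows "summable A" and "(\<lambda>k. A k *v x) sums (suminf A *v x)"
proof -
  show sA: "summable A"
  proof -
    have "summable (\<lambda>k. A k $ i $ j)" for i j
    proof -
      have "summable (\<lambda>k. (A k *v axis j 1) $ i)"
        by (rule bounded_linear.summable[OF bounded_linear_vec_nth assms])
      then show ?thesis by (simp add: matrix_vector_mult_axis column_def)
    qed
    then have "(\<lambda>k. A k $ i $ j) sums (\<Sum>k. A k $ i $ j)" for i j
      by (simp add: summable_sums)
    then have "A sums (\<chi> i j. \<Sum>k. A k $ i $ j)"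
      unfolding sums_def by (intro vec_tendstoI) simp
    then show ?thesis by (rule sums_summable)
  qed
  have "bounded_linear (\<lambda>B :: complex^'n^'m. B *v x)"
    by (intro linear_conv_bounded_linear[THEN iffD1] linearI)
      (simp_all add: matrix_vector_mult_add_rdistrib scaleR_matrix_vector_mult)
  from bounded_linear.sums[OF this summable_sums[OF sA]]
  show "(\<lambda>k. A k *v x) sums (suminf A *v x)" .
qed

lemma transition_matrix_eigenvector:
  fixes M :: "complex^'n^'n::finite"
  assumes M: "hermitian_matrix M" and v: "v \<in> eigenspace M \<theta>"
  shows "transition_matrix M t *v v = exp (\<i> * complex_of_real t * \<theta>) *s v"
proof -
  define N :: "complex^'n^'n" where "N = (\<chi> i j. \<i> * complex_of_real t * M $ i $ j)"
  let ?A = "\<lambda>k. matrix_power N k /\<^sub>R fact k"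
  have N: "N *v x = (\<i> * complex_of_real t) *s (M *v x)" for x
    by (simp add: N_def vec_eq_iff matrix_vector_mult_def sum_distrib_left mult.assoc)
  have eig: "(\<lambda>k. ?A k *v x) sums (exp (\<i> * complex_of_real t * \<eta>) *s x)"
    if "x \<in> eigenspace M \<eta>" for x \<eta>
  proof -
    let ?a = "\<i> * complex_of_real t * \<eta>"
    have "N *v x = ?a *s x"
      using that by (simp add: N eigenspace_def vector_smult_assoc)
    then have *: "?A k *v x = (?a ^ k /\<^sub>R fact k) *s x" for k
      unfolding scaleR_matrix_vector_mult
      by (simp add: matrix_power_eigenvector[of N x ?a] scaleR_eq_scale_of_real vector_smult_assoc
          scaleR_conv_of_real[of _ "_ :: complex"])
    have "bounded_linear (\<lambda>c :: complex. c *s x)"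
      by (intro linear_conv_bounded_linear[THEN iffD1] linearI)
        (simp_all add: vec_eq_iff algebra_simps)
    from bounded_linear.sums[OF this exp_converges[of ?a]] show ?thesis
      by (simp only: *)
  qed
  \<comment> \<open>The infinite sum in \<open>matrix_exp\<close> is meaningful only if the matrix
    series converges, which calls for convergence at every \<open>x\<close> and not just at
    \<open>v\<close>.\<close>
  have "summable (\<lambda>k. ?A k *v x)" for x
    using M
  proof (induction x rule: hermitian_matrix_induct)
    case (add x y)
    then show ?case by (simp only: matrix_vector_right_distrib summable_add)
  next
    case (scaleR c x)
    then show ?case
      by (simp only: scaleR_eq_scale_of_real matrix_vector_mult_scaleC)
        (simp only: scaleR_eq_scale_of_real[symmetric] summable_scaleR_right)
  next
    case (eigenvector v c)
    then show ?case using eig sums_summable by blast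
  qed simp
  from matrix_vector_mult_sums(2)[OF this, of v] eig[OF v]
  show ?thesis
    by (simp add: transition_matrix_def matrix_exp_def N_def[symmetric] sums_unique2)
qed

text \<open>Says that projecting \<open>U(t) x\<close> onto an eigenspace multiplies the projection
  of \<open>x\<close> by the phase. For an eigenvector \<open>x\<close> with another eigenvalue,
  both sides vanish by orthogonality.\<close>

lemma hermitian_inner_eigenvector_transition_matrix:
  assumes M: "hermitian_matrix M" and v: "v \<in> eigenspace M \<theta>"
  shows "hermitian_inner v (transition_matrix M t *v x)
           = exp (\<i> * complex_of_real t * \<theta>) * hermitian_inner v x"
  using M
proof (induction x rule: hermitian_matrix_induct)
  case (eigenvector x c)
  then show ?case
    using hermitian_matrix_eigenspaces_orthogonal[OF M v eigenvector]
    by (cases "\<theta> = complex_of_real c")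
      (simp_all add: transition_matrix_eigenvector[OF M eigenvector] hermitian_inner_scale_right)
qed (simp_all add: matrix_vector_right_distrib hermitian_inner_add_right algebra_simps
    scaleR_eq_scale_of_real matrix_vector_mult_scaleC hermitian_inner_scale_right)

text \<open>For an eigenvector on the left, the conjugate phase pulled out of the first argument
  cancels the phase from the second, the eigenvalue being real.\<close>

lemma hermitian_inner_transition_matrix:
  assumes M: "hermitian_matrix M"
  shows "hermitian_inner (transition_matrix M t *v x) (transition_matrix M t *v y) = hermitian_inner x y"
  using M
proof (induction x rule: hermitian_matrix_induct)
  case (eigenvector v c)
  show ?case
    by (simp add: transition_matrix_eigenvector[OF M eigenvector] hermitian_inner_scale_left
        hermitian_inner_eigenvector_transition_matrix[OF M eigenvector] exp_cnj exp_minus)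
qed (simp_all add: matrix_vector_right_distrib hermitian_inner_add_left algebra_simps
    scaleR_eq_scale_of_real matrix_vector_mult_scaleC hermitian_inner_scale_left)

lemma norm_transition_matrix:
  assumes "hermitian_matrix M"
  shows "norm (transition_matrix M t *v x) = norm x"
proof -
  have "(norm (transition_matrix M t *v x))\<^sup>2 = (norm x)\<^sup>2"
    using hermitian_inner_transition_matrix[OF assms, of t x x]
    by (simp only: hermitian_inner_self of_real_eq_iff)
  then show ?thesis by simp
qed

lemma eq_if_eigenprojections_eq_on_support:
  assumes M: "hermitian_matrix M" and norm: "norm y = norm z"
    and eq: "\<And>\<theta> v. \<theta> \<in> eigenvalue_support M y \<Longrightarrow> v \<in> eigenspace M \<theta> \<Longrightarrow>
               hermitian_inner v y = hermitian_inner v z"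
  shows "y = z"
proof -
  define B where "B = (\<Union>\<theta>\<in>eigenvalue_support M y. eigenspace M \<theta>)"
  \<comment> \<open>The part \<open>r\<close> of \<open>y\<close> outside the span of the support
    eigenspaces is shown to be zero by testing against all eigenvectors: for eigenvalues in the
    support by construction, for the others because \<open>y\<close> and \<open>s\<close> are both
    orthogonal to them.\<close>
  obtain s r where sr: "s \<in> span B" "\<And>v. v \<in> span B \<Longrightarrow> orthogonal r v" "y = s + r"
    using orthogonal_subspace_decomp_exists[of B y] by metis
  have orth: "hermitian_inner v r = 0" if v: "v \<in> eigenspace M \<theta>" for v \<theta>
  proof (cases "\<theta> \<in> eigenvalue_support M y")
    case True
    then have *: "z \<in> eigenspace M \<theta> \<Longrightarrow> inner z r = 0" for z
      using sr(2)[of z] span_base[of z B]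
      by (auto simp: B_def orthogonal_def inner_commute)
    show ?thesis
      by (rule hermitian_inner_eq_0_if_inner_eq_0[OF eigenspace_scale * v])
  next
    case False
    have "hermitian_inner v s = 0"
      using sr(1)
    proof (induction rule: span_induct)
      show "subspace {x. hermitian_inner v x = 0}"
        by (auto simp: subspace_def hermitian_inner_add_right scaleR_eq_scale_of_real
            hermitian_inner_scale_right)
    next
      fix x assume "x \<in> B"
      then show "hermitian_inner v x = 0"
        using False hermitian_matrix_eigenspaces_orthogonal[OF M v] by (auto simp: B_def)
    qed
    moreover have "hermitian_inner v y = 0"
      using False v by (auto simp: eigenvalue_support_alt)
    ultimately show ?thesis by (simp add: sr(3) hermitian_inner_add_right)
  qed
  have "hermitian_inner x r = 0" for x
    using M by (induction x rule: hermitian_matrix_induct)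
      (auto simp: orth hermitian_inner_add_left scaleR_eq_scale_of_real hermitian_inner_scale_left)
  then have "r = 0" by (metis hermitian_inner_self_eq_0_iff)
  then have "y \<in> span B" using sr by simp
  moreover have "inner x (z - y) = 0" if "x \<in> span B" for x
    using that
  proof (induction rule: span_induct)
    show "subspace {x. inner x (z - y) = 0}"
      by (auto simp: subspace_def inner_add_left)
  next
    fix x assume "x \<in> B"
    then show "inner x (z - y) = 0"
      using eq by (auto simp: B_def inner_eq_Re_hermitian_inner hermitian_inner_diff_right)
  qed
  ultimately have "inner y (z - y) = 0" by blast
  moreover have "inner y y = inner z z" using norm by (simp add: norm_eq)
  \<comment> \<open>Since \<open>inner y z = inner y y\<close>, the left side expands to
    \<open>inner z z - inner y y\<close>.\<close>
  ultimately have "inner (z - y) (z - y) = 0"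
    by (simp add: inner_diff_left inner_diff_right inner_commute)
  then show ?thesis by simp
qed

section \<open>Real symmetric matrices and unimodular vectors\<close>

lemma hermitian_matrix_complex_matrix:
  assumes "\<And>i j. R $ i $ j = R $ j $ i"
  shows "hermitian_matrix (complex_matrix R)"
  using assms by (simp add: hermitian_matrix_def complex_matrix_def)

lemma transpose_dot_eq_hermitian_inner: "transpose_dot v x = hermitian_inner (\<chi> i. cnj (v $ i)) x"
  by (simp add: transpose_dot_def hermitian_inner_def)

text \<open>Conjugating the eigenvalue equation entrywise changes neither the real matrix nor the
  real eigenvalue. Needed because \<open>transpose_dot\<close> does not conjugate, unlike
  \<open>hermitian_inner\<close>.\<close>

lemma cnj_eigenspace:
  assumes v: "v \<in> eigenspace (complex_matrix R) \<theta>" and \<theta>: "cnj \<theta> = \<theta>"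
  shows "(\<chi> i. cnj (v $ i)) \<in> eigenspace (complex_matrix R) \<theta>"
proof -
  have "cnj ((complex_matrix R *v v) $ i) = cnj ((\<theta> *s v) $ i)" for i
    using v by (simp add: eigenspace_def)
  then show ?thesis
    using \<theta> by (simp add: eigenspace_def vec_eq_iff matrix_vector_mult_def complex_matrix_def)
qed

lemma norm_unimodular:
  fixes \<mu> :: "complex^'n::finite"
  assumes "unimodular \<mu>"
  shows "norm \<mu> = sqrt (real CARD('n))"
  using assms by (simp add: norm_vec_def L2_set_def unimodular_def)

lemma local_uniform_mixing_iff_unimodular:
  fixes M :: "complex^'n^'n::finite"
  shows "local_uniform_mixing M u t \<longleftrightarrow>
    unimodular (complex_of_real (sqrt (real CARD('n))) *s (transition_matrix M t *v axis u 1))"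
  by (simp add: local_uniform_mixing_def unimodular_def matrix_vector_mult_axis norm_mult
      field_simps)


theorem corollary1:
  fixes E :: "'n::finite set set" and w :: "'n set \<Rightarrow> real"
    and M :: "complex^'n^'n" and u :: 'n and \<tau> :: real
  assumes "connected_weighted_graph E w"
    and "M \<in> complex_matrix ` {adjacency_matrix E w, laplacian_matrix E w, signless_laplacian_matrix E w}"
    and "\<tau> > 0"
  shows "(local_uniform_mixing M u \<tau> \<longleftrightarrow>
            (\<exists>\<mu>. unimodular \<mu> \<and>
               complex_of_real (sqrt (real CARD('n))) *s (transition_matrix M \<tau> *v axis u 1) = \<mu>))
       \<and> (local_uniform_mixing M u \<tau> \<longleftrightarrow>
            (\<exists>\<mu>. unimodular \<mu> \<and>
               (\<forall>\<theta>\<in>eigenvalue_support M (axis u 1).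
                  (complex_of_real (sqrt (real CARD('n))) * exp (\<i> * complex_of_real \<tau> * \<theta>))
                     *s eigenprojection M \<theta> (axis u 1) = eigenprojection M \<theta> \<mu>)))
       \<and> (\<forall>\<mu>. unimodular \<mu> \<longrightarrow>
            ((\<forall>\<theta>\<in>eigenvalue_support M (axis u 1).
                (complex_of_real (sqrt (real CARD('n))) * exp (\<i> * complex_of_real \<tau> * \<theta>))
                   *s eigenprojection M \<theta> (axis u 1) = eigenprojection M \<theta> \<mu>)
             \<longleftrightarrow>
             (\<forall>v \<theta>. eigenpair M v \<theta> \<and> \<theta> \<in> eigenvalue_support M (axis u 1) \<longrightarrow>
                complex_of_real (sqrt (real CARD('n))) * exp (\<i> * complex_of_real \<tau> * \<theta>)
                   * transpose_dot v (axis u 1) = transpose_dot v \<mu>)))"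
proof -
  let ?n = "complex_of_real (sqrt (real CARD('n)))"
  define y where "y = ?n *s (transition_matrix M \<tau> *v axis u 1)"
  obtain R where R: "M = complex_matrix R" "\<And>i j. R $ i $ j = R $ j $ i"
    using assms(2)
    by (auto simp: adjacency_matrix_def laplacian_matrix_def signless_laplacian_matrix_def
        degree_matrix_def insert_commute)
  have M: "hermitian_matrix M"
    using R hermitian_matrix_complex_matrix by blast
  have inner_y: "hermitian_inner v y = ?n * exp (\<i> * complex_of_real \<tau> * \<theta>) * hermitian_inner v (axis u 1)"
    if "v \<in> eigenspace M \<theta>" for v \<theta>
    using hermitian_inner_eigenvector_transition_matrix[OF M that]
    by (simp add: y_def hermitian_inner_scale_right mult.assoc)
  \<comment> \<open>The factor relating the products of \<open>y\<close> and of
    \<open>axis u 1\<close> with an eigenvector is nonzero.\<close>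
  have supp: "eigenvalue_support M y = eigenvalue_support M (axis u 1)"
    by (auto simp: eigenvalue_support_alt inner_y)
  have three: "(\<forall>\<theta>\<in>eigenvalue_support M (axis u 1).
      (?n * exp (\<i> * complex_of_real \<tau> * \<theta>)) *s eigenprojection M \<theta> (axis u 1) = eigenprojection M \<theta> \<mu>)
    \<longleftrightarrow> (\<forall>\<theta>\<in>eigenvalue_support M (axis u 1). \<forall>v\<in>eigenspace M \<theta>. hermitian_inner v y = hermitian_inner v \<mu>)"
    for \<mu>
    by (simp add: scaled_eigenprojection_eq_iff inner_y)
  have norm_y: "norm y = sqrt (real CARD('n))"
  proof -
    have "y = sqrt (real CARD('n)) *\<^sub>R (transition_matrix M \<tau> *v axis u 1)"
      by (simp add: y_def scaleR_eq_scale_of_real)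
    then show ?thesis by (simp add: norm_transition_matrix[OF M])
  qed
  have "y = \<mu>" if "unimodular \<mu>"
    "\<forall>\<theta>\<in>eigenvalue_support M (axis u 1). \<forall>v\<in>eigenspace M \<theta>. hermitian_inner v y = hermitian_inner v \<mu>" for \<mu>
    using that by (intro eq_if_eigenprojections_eq_on_support[OF M])
      (auto simp: norm_y norm_unimodular supp)
  \<comment> \<open>From left to right the witness is \<open>y\<close> itself; conversely any such
    \<mu> equals \<open>y\<close>.\<close>
  then have iff3: "unimodular y \<longleftrightarrow> (\<exists>\<mu>. unimodular \<mu> \<and>
      (\<forall>\<theta>\<in>eigenvalue_support M (axis u 1). \<forall>v\<in>eigenspace M \<theta>. hermitian_inner v y = hermitian_inner v \<mu>))"
    by blast
  \<comment> \<open>Each direction replaces \<open>v\<close> by its entrywise conjugate, which turns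
    \<open>transpose_dot\<close> into \<open>hermitian_inner\<close> and back within the same
    eigenspace.\<close>
  have dot: "(\<forall>\<theta>\<in>eigenvalue_support M (axis u 1). \<forall>v\<in>eigenspace M \<theta>. hermitian_inner v y = hermitian_inner v \<mu>)
    \<longleftrightarrow> (\<forall>v \<theta>. eigenpair M v \<theta> \<and> \<theta> \<in> eigenvalue_support M (axis u 1) \<longrightarrow>
          ?n * exp (\<i> * complex_of_real \<tau> * \<theta>) * transpose_dot v (axis u 1) = transpose_dot v \<mu>)"
    (is "?L \<longleftrightarrow> ?R") for \<mu>
  proof
    assume L: ?L
    show ?R
    proof (intro allI impI)
      fix v \<theta> assume *: "eigenpair M v \<theta> \<and> \<theta> \<in> eigenvalue_support M (axis u 1)"
      then have v: "v \<in> eigenspace M \<theta>" "v \<noteq> 0" by (auto simp: eigenpair_def eigenspace_def)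
      have cv: "(\<chi> i. cnj (v $ i)) \<in> eigenspace M \<theta>"
        using cnj_eigenspace v hermitian_matrix_eigenvalue_real[OF M v] R(1) by blast
      with L * have "hermitian_inner (\<chi> i. cnj (v $ i)) y = hermitian_inner (\<chi> i. cnj (v $ i)) \<mu>"
        by blast
      then show "?n * exp (\<i> * complex_of_real \<tau> * \<theta>) * transpose_dot v (axis u 1) = transpose_dot v \<mu>"
        by (simp add: transpose_dot_eq_hermitian_inner inner_y[OF cv])
    qed
  next
    assume r: ?R
    show ?L
    proof (intro ballI)
      fix \<theta> v assume *: "\<theta> \<in> eigenvalue_support M (axis u 1)" and v: "v \<in> eigenspace M \<theta>"
      show "hermitian_inner v y = hermitian_inner v \<mu>"
      \<comment> \<open>The zero vector lies in the eigenspace but forms no eigenpair; there both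
        products are zero.\<close>
      proof (cases "v = 0")
        case False
        let ?w = "\<chi> i. cnj (v $ i)"
        have "?w \<in> eigenspace M \<theta>"
          using cnj_eigenspace v hermitian_matrix_eigenvalue_real[OF M v False] R(1) by blast
        moreover have "?w \<noteq> 0" using False by (simp add: vec_eq_iff)
        ultimately have "eigenpair M ?w \<theta>" by (simp add: eigenpair_def eigenspace_def)
        with r * have "?n * exp (\<i> * complex_of_real \<tau> * \<theta>) * transpose_dot ?w (axis u 1) = transpose_dot ?w \<mu>"
          by blast
        then show ?thesis
          by (simp add: transpose_dot_eq_hermitian_inner inner_y[OF v])
      qed simp
    qed
  qed
  have "local_uniform_mixing M u \<tau> \<longleftrightarrow> unimodular y"
    by (simp add: local_uniform_mixing_iff_unimodular y_def)
  then show ?thesis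
    unfolding three dot[symmetric] y_def[symmetric] using iff3 by simp
qed

end
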